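(* Let $N$ be a prime number and let $d\in\mathbb{N}$, $d\le N$. Let $\mathcal{O}_{[n]}$ be an orbit of $\mathbb{A}_N^d$ (the orbit of the class $[n]$ of a $d$-tuple $n=(n_1,\ldots,n_d)$ of pairwise distinct elements of $\mathbb{Z}_N$) such that $|\mathcal{O}_{[n]}|=(N-1)/c$, and let $\Phi_n$ be the harmonic frame that corresponds to $\mathcal{O}_{[n]}$ under the one-to-one correspondence $[\Phi_n]\leftrightarrow\mathcal{O}_{[n]}$. Then $$\langle \mathrm{diag}(\omega^{n_1},\ldots,\omega^{n_d}),\,Q\rangle\subseteq\mathrm{Sym}(\Phi_n),$$ where $\mathrm{diag}(\omega^{n_1},\ldots,\omega^{n_d})$ denotes the $d\times d$ matrix with $\omega^{n_1},\ldots,\omega^{n_d}$ on the diagonal and zeros elsewhere, $\omega=e^{2\pi i/N}$, $Q$ is a $d\times d$ permutation matrix dependent on $\Phi_n$, and $|\langle Q\rangle|=c$. (That is, there exists such a permutation matrix $Q$; $\langle\cdot\rangle$ denotes the generated subgroup.)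
   Context: $\mathbb{Z}_N$ denotes the integers mod $N$, and $\mathbb{Z}_N^\times$ its multiplicative group of units. $\mathbb{A}_N^d$ is the quotient of the set of $d$-tuples of pairwise distinct elements of $\mathbb{Z}_N$ by permutation of coordinates; the class of $n$ is written $[n]=[n_1,\ldots,n_d]$. The group $\mathbb{Z}_N^\times$ acts on $\mathbb{A}_N^d$ by $m\cdot[n]=[mn_1,\ldots,mn_d]$, and $\mathcal{O}_{[n]}=\{m\cdot[n]:m\in\mathbb{Z}_N^\times\}$ is the orbit of $[n]$. The frame $\Phi_n=\{\phi_0,\ldots,\phi_{N-1}\}\subset\mathbb{C}^d$ with generators $n_1,\ldots,n_d$ is the set of vectors $\phi_m=\frac{1}{\sqrt d}(e^{2\pi i m n_1/N},\ldots,e^{2\pi i m n_d/N})$, $m=0,\ldots,N-1$. Two such frames $\Phi,\Psi$ are equivalent if $\Phi=U\Psi$ (as sets) for some unitary $U$ on $\mathbb{C}^d$, and $[\Phi_n]$ denotes the equivalence class of $\Phi_n$; the map $[\Phi_n]\mapsto\mathcal{O}_{[n]}$ is a one-to-one correspondence between equivalence classes and orbits. The symmetry group is $\mathrm{Sym}(\Phi_n)=\{U\in\mathcal{U}(\mathbb{C}^d): U\Phi_n=\Phi_n\}$ (equality of sets), where $\mathcal{U}(\mathbb{C}^d)$ is the group of unitary transformations of $\mathbb{C}^d$.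
   Formalization: The case d = 1, n = (0), N > 2 is excluded: there the orbit has one element, so c = N−1 > 1, while the only 1×1 permutation matrix is the identity, so |⟨Q⟩| = 1 and the claim fails. *)

theory Defs
  imports
    "HOL-Analysis.Analysis"
    "HOL-Number_Theory.Residues"
    "HOL-Algebra.Generated_Groups"
begin

text \<open>
  The integers modulo \<open>N\<close> are \<^term>\<open>residue_ring (int N)\<close>, with carrier
  \<open>{0..int N - 1}\<close>. A \<open>d\<close>-tuple is a vector indexed by a finite type \<open>'d\<close>, so \<open>d = CARD('d) \<ge> 1\<close>.
\<close>

definition distinct_tuples :: "nat \<Rightarrow> (int ^ 'd) set" where
  "distinct_tuples N =
     {n. (\<forall>i. n $ i \<in> carrier (residue_ring (int N))) \<and> inj (\<lambda>i. n $ i)}"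

definition permutation_rel :: "nat \<Rightarrow> ((int ^ 'd) \<times> (int ^ 'd)) set" where
  "permutation_rel N =
     {(n, n'). n \<in> distinct_tuples N \<and> n' \<in> distinct_tuples N \<and>
               (\<exists>p. bij p \<and> n' = (\<chi> i. n $ p i))}"

definition tuple_classes :: "nat \<Rightarrow> (int ^ 'd) set set" where
  "tuple_classes N = distinct_tuples N // permutation_rel N"

definition tuple_class :: "nat \<Rightarrow> int ^ 'd \<Rightarrow> (int ^ 'd) set" where
  "tuple_class N n = permutation_rel N `` {n}"

definition scale_tuple :: "nat \<Rightarrow> int \<Rightarrow> int ^ 'd \<Rightarrow> int ^ 'd" where
  "scale_tuple N m n = (\<chi> i. m \<otimes>\<^bsub>residue_ring (int N)\<^esub> (n $ i))"

text \<open>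
  The action on a class is the image of the class; for a unit \<open>m\<close> this is again a class, namely
  \<open>[m n]\<close>; see \<open>act_class_tuple_class\<close> below.
\<close>

definition act_class :: "nat \<Rightarrow> int \<Rightarrow> (int ^ 'd) set \<Rightarrow> (int ^ 'd) set" where
  "act_class N m X = scale_tuple N m ` X"

definition class_orbit :: "nat \<Rightarrow> (int ^ 'd) set \<Rightarrow> (int ^ 'd) set set" where
  "class_orbit N X = (\<lambda>m. act_class N m X) ` Units (residue_ring (int N))"

text \<open>
  The tuple \<open>n = 0\<close> is pairwise distinct only for \<open>d = 1\<close>. Its orbit has one element, so
  \<open>c = N - 1\<close>, while the only permutation matrix of size one is the identity. A permutation matrix
  of order \<open>c\<close> therefore exists for \<open>n = 0\<close> only if \<open>N = 2\<close>.
\<close>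

definition root_unity :: "nat \<Rightarrow> complex" where
  "root_unity N = exp (2 * of_real pi * \<i> / of_nat N)"

definition frame_vector :: "nat \<Rightarrow> int ^ 'd \<Rightarrow> nat \<Rightarrow> complex ^ 'd" where
  "frame_vector N n m =
     (\<chi> j. exp (2 * of_real pi * \<i> * of_nat m * of_int (n $ j) / of_nat N)
            / of_real (sqrt (real CARD('d))))"

definition harmonic_frame :: "nat \<Rightarrow> int ^ 'd \<Rightarrow> (complex ^ 'd) set" where
  "harmonic_frame N n = frame_vector N n ` {0..<N}"

definition conj_transpose :: "complex ^ 'd ^ 'd \<Rightarrow> complex ^ 'd ^ 'd" where
  "conj_transpose A = (\<chi> i j. cnj (A $ j $ i))"

definition unitary_group :: "(complex ^ 'd ^ 'd) monoid" where
  "unitary_group =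
     \<lparr>carrier = {A. conj_transpose A ** A = mat 1 \<and> A ** conj_transpose A = mat 1},
      mult = (**), one = mat 1\<rparr>"

definition Sym :: "(complex ^ 'd) set \<Rightarrow> (complex ^ 'd ^ 'd) set" where
  "Sym \<Phi> = {U \<in> carrier unitary_group. (\<lambda>v. U *v v) ` \<Phi> = \<Phi>}"

definition diag :: "complex ^ 'd \<Rightarrow> complex ^ 'd ^ 'd" where
  "diag v = (\<chi> i j. if i = j then v $ i else 0)"

definition permutation_matrix :: "complex ^ 'd ^ 'd \<Rightarrow> bool" where
  "permutation_matrix Q \<longleftrightarrow> (\<exists>p. bij p \<and> Q = (\<chi> i j. if i = p j then 1 else 0))"

lemma equiv_permutation_rel: "equiv (distinct_tuples N) (permutation_rel N)"
proof (rule equivI)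
  show "permutation_rel N \<subseteq> distinct_tuples N \<times> distinct_tuples N"
    by (auto simp: permutation_rel_def)
  show "refl_on (distinct_tuples N) (permutation_rel N)"
    by (auto simp: permutation_rel_def refl_on_def intro!: exI[of _ id])
  show "sym (permutation_rel N)"
  proof (rule symI)
    fix n n' :: "int ^ 'd" assume a: "(n, n') \<in> permutation_rel N"
    then obtain p where "bij p" "n' = (\<chi> i. n $ p i)" by (auto simp: permutation_rel_def)
    then have "bij (inv_into UNIV p)" "n = (\<chi> i. n' $ inv_into UNIV p i)"
      by (auto simp: vec_eq_iff bij_imp_bij_inv bij_is_surj surj_f_inv_f)
    then show "(n', n) \<in> permutation_rel N" using a by (auto simp only: permutation_rel_def
        mem_Collect_eq prod.case)
  qed
  show "trans (permutation_rel N)"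
  proof (rule transI)
    fix n n' n'' :: "int ^ 'd"
    assume a: "(n, n') \<in> permutation_rel N" "(n', n'') \<in> permutation_rel N"
    then obtain p q where "bij p" "n' = (\<chi> i. n $ p i)" "bij q" "n'' = (\<chi> i. n' $ q i)"
      by (auto simp: permutation_rel_def)
    then have "bij (p \<circ> q)" "n'' = (\<chi> i. n $ (p \<circ> q) i)"
      by (auto simp: vec_eq_iff bij_comp)
    then show "(n, n'') \<in> permutation_rel N" using a by (auto simp only: permutation_rel_def
        mem_Collect_eq prod.case)
  qed
qed

lemma tuple_class_in_tuple_classes:
  "n \<in> distinct_tuples N \<Longrightarrow> tuple_class N n \<in> tuple_classes N"
  by (simp add: tuple_class_def tuple_classes_def quotientI)

lemma scale_tuple_distinct:
  assumes "1 < N" "m \<in> Units (residue_ring (int N))" "n \<in> distinct_tuples N"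
  shows "scale_tuple N m n \<in> distinct_tuples N"
proof -
  interpret residues "int N" "residue_ring (int N)" using assms(1) by unfold_locales auto
  have m: "m \<in> carrier (residue_ring (int N))" using assms(2) by blast
  have n: "n $ i \<in> carrier (residue_ring (int N))" for i
    using assms(3) by (simp add: distinct_tuples_def)
  have "inj (\<lambda>i. n $ i)" using assms(3) by (simp add: distinct_tuples_def)
  then have "inj (\<lambda>i. m \<otimes>\<^bsub>residue_ring (int N)\<^esub> (n $ i))"
    using Units_l_cancel[OF assms(2) n n] by (auto simp: inj_def)
  then show ?thesis using m n by (auto simp: distinct_tuples_def scale_tuple_def inj_def)
qed

lemma act_class_tuple_class:
  assumes "1 < N" "m \<in> Units (residue_ring (int N))" "n \<in> distinct_tuples N"
  shows "act_class N m (tuple_class N n) = tuple_class N (scale_tuple N m n)"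
proof (intro equalityI subsetI)
  fix x assume "x \<in> act_class N m (tuple_class N n)"
  then obtain p where p: "bij p" and d: "(\<chi> i. n $ p i) \<in> distinct_tuples N"
    and x: "x = scale_tuple N m (\<chi> i. n $ p i)"
    by (auto simp: act_class_def tuple_class_def permutation_rel_def)
  have "x = (\<chi> i. scale_tuple N m n $ p i)" by (simp add: x scale_tuple_def)
  then show "x \<in> tuple_class N (scale_tuple N m n)"
    using p scale_tuple_distinct[OF assms] scale_tuple_distinct[OF assms(1,2) d, folded x]
    by (auto simp only: tuple_class_def permutation_rel_def Image_singleton_iff mem_Collect_eq
        prod.case)
next
  fix x assume "x \<in> tuple_class N (scale_tuple N m n)"
  then obtain p where p: "bij p" and x: "x = scale_tuple N m (\<chi> i. n $ p i)"
    by (auto simp: tuple_class_def permutation_rel_def scale_tuple_def)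
  have "(\<chi> i. n $ p i) \<in> distinct_tuples N"
    using assms(3) p by (auto simp: distinct_tuples_def bij_def inj_def)
  then show "x \<in> act_class N m (tuple_class N n)"
    using assms(3) p x by (auto simp: act_class_def tuple_class_def permutation_rel_def)
qed

lemma conj_transpose_conj_transpose [simp]: "conj_transpose (conj_transpose A) = A"
  by (simp add: conj_transpose_def vec_eq_iff)

lemma conj_transpose_mult: "conj_transpose (A ** B) = conj_transpose B ** conj_transpose A"
  by (simp add: conj_transpose_def matrix_matrix_mult_def vec_eq_iff mult.commute)

lemma group_unitary_group: "group (unitary_group :: (complex ^ 'd ^ 'd) monoid)"
proof (rule groupI)
  fix x y :: "complex ^ 'd ^ 'd"
  assume x: "x \<in> carrier unitary_group" and y: "y \<in> carrier unitary_group"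
  have "conj_transpose y ** conj_transpose x ** (x ** y)
        = conj_transpose y ** (conj_transpose x ** x) ** y"
       "x ** y ** (conj_transpose y ** conj_transpose x)
        = x ** (y ** conj_transpose y) ** conj_transpose x"
    by (simp_all only: matrix_mul_assoc)
  then show "x \<otimes>\<^bsub>unitary_group\<^esub> y \<in> carrier unitary_group"
    using x y by (simp add: unitary_group_def conj_transpose_mult)
next
  fix x :: "complex ^ 'd ^ 'd"
  assume "x \<in> carrier unitary_group"
  then show "\<exists>y\<in>carrier unitary_group. y \<otimes>\<^bsub>unitary_group\<^esub> x = \<one>\<^bsub>unitary_group\<^esub>"
    by (intro bexI[of _ "conj_transpose x"]) (auto simp: unitary_group_def)
next
  show "\<one>\<^bsub>unitary_group\<^esub> \<in> carrier (unitary_group :: (complex ^ 'd ^ 'd) monoid)"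
  proof -
    have "conj_transpose (mat 1) = (mat 1 :: complex ^ 'd ^ 'd)"
      by (simp add: conj_transpose_def mat_def vec_eq_iff)
    then show ?thesis by (simp add: unitary_group_def)
  qed
qed (auto simp: unitary_group_def matrix_mul_assoc)

lemma subgroup_Sym: "subgroup (Sym \<Phi>) unitary_group"
proof -
  interpret group unitary_group by (rule group_unitary_group)
  show ?thesis
  proof (rule subgroupI)
    have "\<one>\<^bsub>unitary_group\<^esub> \<in> Sym \<Phi>"
      using one_closed by (simp add: Sym_def unitary_group_def)
    then show "Sym \<Phi> \<noteq> {}" by blast
  next
    fix U assume U: "U \<in> Sym \<Phi>"
    then have Uc: "U \<in> carrier unitary_group" and img: "(\<lambda>v. U *v v) ` \<Phi> = \<Phi>"
      by (auto simp: Sym_def)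
    have "inv\<^bsub>unitary_group\<^esub> U ** U = mat 1"
      using l_inv[OF Uc] by (simp add: unitary_group_def)
    then have "(\<lambda>v. (inv\<^bsub>unitary_group\<^esub> U) *v (U *v v)) ` \<Phi> = \<Phi>"
      by (simp add: matrix_vector_mul_assoc)
    then have "(\<lambda>v. (inv\<^bsub>unitary_group\<^esub> U) *v v) ` \<Phi> = \<Phi>"
      using img by (metis image_image)
    then show "inv\<^bsub>unitary_group\<^esub> U \<in> Sym \<Phi>" using Uc by (simp add: Sym_def)
  next
    fix U V assume U: "U \<in> Sym \<Phi>" and V: "V \<in> Sym \<Phi>"
    have "(\<lambda>v. U *v (V *v v)) ` \<Phi> = (\<lambda>v. U *v v) ` (\<lambda>v. V *v v) ` \<Phi>"
      by (simp add: image_image)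
    also have "\<dots> = \<Phi>" using U V by (simp add: Sym_def)
    finally have "(\<lambda>v. (U ** V) *v v) ` \<Phi> = \<Phi>"
      by (simp add: matrix_vector_mul_assoc)
    then show "U \<otimes>\<^bsub>unitary_group\<^esub> V \<in> Sym \<Phi>"
      using U V m_closed[of U V] by (simp add: Sym_def unitary_group_def)
  qed (auto simp: Sym_def)
qed

lemma permutation_matrix_unitary:
  assumes "permutation_matrix Q"
  shows "Q \<in> carrier unitary_group"
proof -
  obtain p where p: "bij p" and Q: "Q = (\<chi> i j. if i = p j then 1 else 0)"
    using assms by (auto simp: permutation_matrix_def)
  have inj: "p i = p j \<longleftrightarrow> i = j" for i j using p by (auto simp: bij_def inj_def)
  have eq: "i = p j \<longleftrightarrow> j = inv_into UNIV p i" for i j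
    using p by (metis bij_inv_eq_iff)
  have inj': "inv_into UNIV p i = inv_into UNIV p j \<longleftrightarrow> i = j" for i j
    using p by (metis bij_inv_eq_iff)
  have 1: "conj_transpose Q ** Q = mat 1"
    by (auto simp: Q conj_transpose_def matrix_matrix_mult_def mat_def vec_eq_iff inj
        if_distrib[of cnj] if_distrib[of "\<lambda>x. x * _"] cong: if_cong)
  have 2: "Q ** conj_transpose Q = mat 1"
    by (auto simp: Q conj_transpose_def matrix_matrix_mult_def mat_def vec_eq_iff eq inj'
        if_distrib[of cnj] if_distrib[of "\<lambda>x. x * _"] cong: if_cong)
  from 1 2 show ?thesis by (simp add: unitary_group_def)
qed

end

theory Submission
  imports Defs
begin

text \<open>
  The stabilizer of \<open>[n]\<close> has order \<open>c\<close> by orbit counting, and it is cyclic, being a subgroup of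
  the multiplicative group of a finite field. A generator \<open>a\<close> permutes the entries of \<open>n\<close>, say
  \<open>a n\<^sub>i = n\<^bsub>q i\<^esub>\<close>. The permutation matrix of \<open>q\<close> then sends \<open>\<phi>\<^sub>m\<close> to
  \<open>\<phi>\<^bsub>a m\<^esub>\<close>, and its order is that of \<open>a\<close>, since \<open>n\<close> has a nonzero entry or \<open>a = 1\<close>.
  The diagonal matrix sends \<open>\<phi>\<^sub>m\<close> to \<open>\<phi>\<^bsub>m + 1\<^esub>\<close>.
\<close>

section \<open>Orbits and subgroups of cyclic groups\<close>

text \<open>The action laws are assumed only at the point \<open>X\<close>: \<open>act_class\<close>
  reduces modulo \<open>N\<close>, so its identity law fails on sets containing tuples with
  unreduced entries. The fibres of \<open>\<lambda>x. f x X\<close> are the left cosets of the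
  stabilizer, hence all of its size.\<close>

lemma (in group)
  assumes fin: "finite (carrier G)"
    and one: "f \<one> X = X"
    and mult: "\<And>x y. x \<in> carrier G \<Longrightarrow> y \<in> carrier G \<Longrightarrow> f (x \<otimes> y) X = f x (f y X)"
  shows subgroup_stabilizer: "subgroup {x \<in> carrier G. f x X = X} G"
    and card_orbit_times_stabilizer:
      "card ((\<lambda>x. f x X) ` carrier G) * card {x \<in> carrier G. f x X = X} = order G"
proof -
  let ?H = "{x \<in> carrier G. f x X = X}"
  have cancel: "f (inv x \<otimes> y) X = X"
    if "x \<in> carrier G" "y \<in> carrier G" "f y X = f x X" for x y
    using that mult[of "inv x" x] by (simp add: mult one)
  show "subgroup ?H G"
  proof (rule subgroupI)
    show "?H \<noteq> {}" using one by blast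
    show "inv x \<in> ?H" if "x \<in> ?H" for x
      using that cancel[of x \<one>] one by simp
  qed (auto simp: mult)
  have fibre: "card {y \<in> carrier G. f y X = f x X} = card ?H" if x: "x \<in> carrier G" for x
  proof -
    have "{y \<in> carrier G. f y X = f x X} = (\<lambda>h. x \<otimes> h) ` ?H"
    proof (intro equalityI subsetI)
      fix y assume y: "y \<in> {y \<in> carrier G. f y X = f x X}"
      then have "y = x \<otimes> (inv x \<otimes> y)" using x by (simp add: inv_solve_left' m_assoc[symmetric])
      then show "y \<in> (\<lambda>h. x \<otimes> h) ` ?H"
        using x y cancel by (intro image_eqI[of _ _ "inv x \<otimes> y"]) auto
    qed (use x in \<open>auto simp: mult\<close>)
    moreover have "inj_on (\<lambda>h. x \<otimes> h) ?H"
      using x by (auto simp: inj_on_def)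
    ultimately show ?thesis by (simp add: card_image)
  qed
  have "order G = (\<Sum>Y\<in>(\<lambda>x. f x X) ` carrier G. \<Sum>y | y \<in> carrier G \<and> f y X = Y. 1)"
    unfolding order_def card_eq_sum by (rule sum.image_gen[OF fin])
  also have "\<dots> = (\<Sum>Y\<in>(\<lambda>x. f x X) ` carrier G. card ?H)"
    by (intro sum.cong) (auto simp: fibre)
  finally show "card ((\<lambda>x. f x X) ` carrier G) * card ?H = order G" by simp
qed

text \<open>With \<open>e\<close> the index of \<open>H\<close>, the power \<open>g [^] e\<close>
  has order \<open>card H\<close>. Raising an element of \<open>H\<close> to the exponent
  \<open>card H\<close> gives \<open>\<one>\<close>, which forces that element to be a power of
  \<open>g [^] e\<close>; equal sizes then identify \<open>H\<close> with the group generated by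
  this power.\<close>

lemma (in group) subgroup_of_cyclic_generator:
  assumes fin: "finite (carrier G)"
    and g: "g \<in> carrier G" "carrier G = range (\<lambda>i::nat. g [^] i)"
    and H: "subgroup H G"
  obtains a where "a \<in> H" "ord a = card H"
proof -
  define e where "e = card (rcosets H)"
  have eH: "e * card H = order G"
    unfolding e_def using lagrange_finite[OF fin H] .
  then have pos: "e > 0" "card H > 0"
    using fin order_gt_0_iff_finite by (auto intro!: gr0I)
  have "generate G {g} = carrier G"
    using generate_pow_on_finite_carrier[OF fin g(1)] g(2) by auto
  then have ordg: "ord g = e * card H"
    using generate_pow_card[OF g(1)] eH by (simp add: order_def)
  have a: "ord (g [^] e) = card H"
    using ord_pow[OF g(1)] ordg pos by simp
  have gen: "generate G {g [^] e} = range (\<lambda>i::nat. (g [^] e) [^] i)"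
    using generate_pow_on_finite_carrier[OF fin, of "g [^] e"] g(1) by auto
  have "H \<subseteq> generate G {g [^] e}"
  proof
    fix x assume x: "x \<in> H"
    interpret H: group "G\<lparr>carrier := H\<rparr>" using H by (rule subgroup_imp_group)
    have "x [^] card H = \<one>"
      using H.pow_order_eq_1[of x] x by (simp add: order_def nat_pow_def)
    moreover obtain k :: nat where k: "x = g [^] k"
      using subgroup.mem_carrier[OF H x] unfolding g(2) by blast
    ultimately have "g [^] (k * card H) = \<one>" using g(1) by (simp add: nat_pow_pow)
    then have "e * card H dvd k * card H"
      unfolding pow_eq_id[OF g(1)] ordg .
    then obtain i where "k = e * i" using pos by (auto elim: dvdE)
    then have "x = (g [^] e) [^] i" using k g(1) by (simp add: nat_pow_pow)
    then show "x \<in> generate G {g [^] e}" using gen by blast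
  qed
  moreover have "card (generate G {g [^] e}) = card H"
    using generate_pow_card[of "g [^] e"] a g(1) by simp
  moreover have "finite (generate G {g [^] e})"
    using finite_subset[OF generate_incl fin] g(1) by simp
  ultimately have "H = generate G {g [^] e}" by (intro card_subset_eq) auto
  then have "g [^] e \<in> H" using generate.incl[of "g [^] e" "{g [^] e}" G] by blast
  then show ?thesis using a that by blast
qed

section \<open>Matrices of permutations and symmetries of harmonic frames\<close>

text \<open>The orientation is transposed relative to \<open>permutation_matrix\<close>, so that the
  matrix reindexes a vector by \<open>q\<close> itself and not by its inverse. Products therefore
  compose in reverse order.\<close>

definition perm_mat :: "('d \<Rightarrow> 'd) \<Rightarrow> complex ^ 'd ^ 'd" where
  "perm_mat q = (\<chi> i j. if j = q i then 1 else 0)"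

lemma perm_mat_mult_vec: "(perm_mat q *v v) $ i = v $ q i"
  by (simp add: perm_mat_def matrix_vector_mult_def if_distrib[of "\<lambda>x. x * _"] cong: if_cong)

lemma perm_mat_mult: "perm_mat q ** perm_mat r = perm_mat (r \<circ> q)"
  by (simp add: perm_mat_def matrix_matrix_mult_def vec_eq_iff if_distrib[of "\<lambda>x. x * _"]
      cong: if_cong)

lemma perm_mat_id: "perm_mat id = mat 1"
  by (auto simp: perm_mat_def mat_def vec_eq_iff)

lemma perm_mat_eq_one_iff: "perm_mat q = mat 1 \<longleftrightarrow> q = id"
proof
  assume eq: "perm_mat q = mat 1"
  have "q i = i" for i
  proof (rule ccontr)
    assume "q i \<noteq> i"
    then show False
      using arg_cong[OF eq, of "\<lambda>A. A $ i $ q i"] by (simp add: perm_mat_def mat_def)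
  qed
  then show "q = id" by (simp add: fun_eq_iff)
qed (simp add: perm_mat_id)

lemma permutation_matrix_perm_mat:
  assumes "bij q"
  shows "permutation_matrix (perm_mat q)"
  unfolding permutation_matrix_def
proof (intro exI conjI)
  \<comment> \<open>Row \<open>i\<close> has its one in column \<open>q i\<close>; read by columns,
    the permutation is the inverse of \<open>q\<close>.\<close>
  show "bij (inv_into UNIV q)" using assms by (rule bij_imp_bij_inv)
  show "perm_mat q = (\<chi> i j. if i = inv_into UNIV q j then 1 else 0)"
    using assms by (auto simp: perm_mat_def vec_eq_iff bij_inv_eq_iff)
qed

lemma perm_mat_pow: "perm_mat q [^]\<^bsub>unitary_group\<^esub> (k::nat) = perm_mat (q ^^ k)"
proof (induction k)
  case 0
  then show ?case by (simp add: nat_pow_def unitary_group_def perm_mat_id[symmetric] id_def)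
next
  case (Suc k)
  have "perm_mat q [^]\<^bsub>unitary_group\<^esub> Suc k
    = (perm_mat q [^]\<^bsub>unitary_group\<^esub> k) ** perm_mat q"
    by (simp add: nat_pow_def unitary_group_def)
  then show ?case using Suc by (simp add: perm_mat_mult o_def)
qed

section \<open>Roots of unity and the periodic indexing of frame vectors\<close>

lemma root_unity_powi: "root_unity N powi k = exp (2 * of_real pi * \<i> * of_int k / of_nat N)"
  by (simp add: root_unity_def exp_power_int mult_ac)

lemma root_unity_powi_add: "root_unity N powi (k + l) = root_unity N powi k * root_unity N powi l"
  by (simp add: power_int_add root_unity_def)

lemma root_unity_powi_mod:
  assumes "N > 0"
  shows "root_unity N powi (k mod int N) = root_unity N powi k"
proof -
  have "root_unity N powi int N = 1"
    using assms unfolding root_unity_powi by (simp add: mult_ac)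
  then have "root_unity N powi (int N * (k div int N)) = 1"
    by (simp add: power_int_mult)
  then show ?thesis
    using root_unity_powi_add[of N "int N * (k div int N)" "k mod int N"] by simp
qed

lemma root_unity_powi_cong:
  assumes "N > 0" "[k = l] (mod int N)"
  shows "root_unity N powi k = root_unity N powi l"
  using assms root_unity_powi_mod by (metis cong_def)

lemma frame_vector_nth:
  fixes n :: "int ^ 'd"
  shows "frame_vector N n m $ j = root_unity N powi (int m * n $ j) / of_real (sqrt (real CARD('d)))"
  by (simp add: frame_vector_def root_unity_powi mult_ac)

text \<open>Frame vectors are periodic in the index with period \<open>N\<close>, so indices such as
  \<open>Suc m\<close> and \<open>m * nat a\<close> may be used without reduction.\<close>

lemma frame_vector_in_harmonic_frame:
  assumes "N > 0"
  shows "frame_vector N n m \<in> harmonic_frame N n"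
proof -
  have "[int m * n $ j = int (m mod N) * n $ j] (mod int N)" for j
    unfolding cong_def zmod_int by (rule mod_mult_left_eq[symmetric])
  then have "frame_vector N n m = frame_vector N n (m mod N)"
    unfolding vec_eq_iff frame_vector_nth by (metis root_unity_powi_cong[OF assms])
  then show ?thesis using assms by (simp add: harmonic_frame_def)
qed

text \<open>A unitary map is injective and the frame is finite, so mapping the frame into itself is enough.\<close>

lemma Sym_harmonic_frameI:
  assumes "U \<in> carrier unitary_group"
    and "\<And>m. U *v frame_vector N n m \<in> harmonic_frame N n"
  shows "U \<in> Sym (harmonic_frame N n)"
proof -
  have "inj (\<lambda>v. U *v v)"
    using assms(1)
    by (auto simp: unitary_group_def matrix_vector_mul_assoc
        intro!: inj_on_inverseI[of _ "(*v) (conj_transpose U)"])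
  then have "inj_on (\<lambda>v. U *v v) (harmonic_frame N n)" by (rule inj_on_subset) simp
  moreover have "(\<lambda>v. U *v v) ` harmonic_frame N n \<subseteq> harmonic_frame N n"
    using assms(2) by (auto simp: harmonic_frame_def)
  moreover have "finite (harmonic_frame N n)" by (simp add: harmonic_frame_def)
  ultimately show ?thesis using assms(1) by (simp add: Sym_def endo_inj_surj)
qed

lemma diag_mult_vec: "(diag v *v w) $ i = v $ i * w $ i"
  by (simp add: diag_def matrix_vector_mult_def if_distrib[of "\<lambda>x. x * _"] cong: if_cong)

lemma diag_unitary:
  assumes "\<And>i. cmod (v $ i) = 1"
  shows "diag v \<in> carrier unitary_group"
proof -
  have "v $ i * cnj (v $ i) = 1" for i
    using assms complex_norm_square[of "v $ i"] by simp
  then show ?thesis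
    by (auto simp: unitary_group_def diag_def conj_transpose_def matrix_matrix_mult_def mat_def
        vec_eq_iff mult.commute if_distrib[of cnj] if_distrib[of "\<lambda>x. x * _"] cong: if_cong)
qed

lemma diag_in_Sym:
  assumes "N > 0"
  shows "diag (\<chi> j. root_unity N powi (n $ j)) \<in> Sym (harmonic_frame N n)"
proof (rule Sym_harmonic_frameI)
  show "diag (\<chi> j. root_unity N powi (n $ j)) \<in> carrier unitary_group"
    by (intro diag_unitary) (simp add: root_unity_def norm_power_int)
next
  fix m
  have "diag (\<chi> j. root_unity N powi (n $ j)) *v frame_vector N n m = frame_vector N n (Suc m)"
    by (simp add: vec_eq_iff diag_mult_vec frame_vector_nth root_unity_powi_add[symmetric]
        algebra_simps)
  then show "diag (\<chi> j. root_unity N powi (n $ j)) *v frame_vector N n m \<in> harmonic_frame N n"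
    using frame_vector_in_harmonic_frame[OF assms] by simp
qed

lemma perm_mat_in_Sym:
  assumes "N > 0" "bij q" "a \<ge> 0" and q: "\<And>i. [a * n $ i = n $ q i] (mod int N)"
  shows "perm_mat q \<in> Sym (harmonic_frame N n)"
proof (rule Sym_harmonic_frameI)
  show "perm_mat q \<in> carrier unitary_group"
    using permutation_matrix_unitary[OF permutation_matrix_perm_mat[OF assms(2)]] .
next
  fix m
  \<comment> \<open>Up to normalization, these are entry \<open>i\<close> of the image of the vector
    with index \<open>m\<close> and entry \<open>i\<close> of the vector with index
    \<open>m * nat a\<close>. Indices are natural numbers, and \<open>a \<ge> 0\<close> turns
    \<open>int (nat a)\<close> back into \<open>a\<close>.\<close>
  have "root_unity N powi (int m * n $ q i) = root_unity N powi (int (m * nat a) * n $ i)" for i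
  proof (rule root_unity_powi_cong[OF assms(1)])
    show "[int m * n $ q i = int (m * nat a) * n $ i] (mod int N)"
      using cong_scalar_left[OF cong_sym[OF q[of i]], of "int m"] assms(3) by (simp add: mult_ac)
  qed
  then have "perm_mat q *v frame_vector N n m = frame_vector N n (m * nat a)"
    by (simp add: vec_eq_iff perm_mat_mult_vec frame_vector_nth)
  then show "perm_mat q *v frame_vector N n m \<in> harmonic_frame N n"
    using frame_vector_in_harmonic_frame[OF assms(1)] by simp
qed

section \<open>The stabilizer of a class of tuples\<close>

lemma scale_tuple_mult:
  assumes "1 < N" "n \<in> distinct_tuples N"
    and "x \<in> carrier (residue_ring (int N))" "y \<in> carrier (residue_ring (int N))"
  shows "scale_tuple N (x \<otimes>\<^bsub>residue_ring (int N)\<^esub> y) n = scale_tuple N x (scale_tuple N y n)"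
proof -
  interpret residues "int N" "residue_ring (int N)" using assms(1) by unfold_locales auto
  show ?thesis using assms by (simp add: scale_tuple_def distinct_tuples_def vec_eq_iff m_assoc)
qed

lemma scale_tuple_one:
  assumes "1 < N" "n \<in> distinct_tuples N"
  shows "scale_tuple N \<one>\<^bsub>residue_ring (int N)\<^esub> n = n"
proof -
  interpret residues "int N" "residue_ring (int N)" using assms(1) by unfold_locales auto
  show ?thesis using assms by (simp add: scale_tuple_def distinct_tuples_def vec_eq_iff)
qed

lemma tuple_class_eqD:
  assumes "n \<in> distinct_tuples N" "n' \<in> distinct_tuples N" "tuple_class N n' = tuple_class N n"
  obtains q where "bij q" "\<And>i. n' $ i = n $ q i"
proof -
  have "(n, n') \<in> permutation_rel N"
    using assms eq_equiv_class_iff[OF equiv_permutation_rel] by (metis tuple_class_def)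
  then show ?thesis using that by (auto simp: permutation_rel_def)
qed

text \<open>The unit \<open>a\<close> generates the stabilizer of the class, so its order is the
  stabilizer size in the orbit count.\<close>

lemma stabilizer_generator:
  fixes n :: "int ^ 'd"
  assumes prime: "prime N" and n: "n \<in> distinct_tuples N"
  defines "R \<equiv> residue_ring (int N)"
  obtains a where "a \<in> Units R"
    and "act_class N a (tuple_class N n) = tuple_class N n"
    and "card (class_orbit N (tuple_class N n)) * group.ord (units_of R) a = N - 1"
proof -
  interpret residues_prime N R using prime by unfold_locales (auto simp: R_def)
  interpret U: group "units_of R" by (rule units_group)
  have N1: "1 < N" using prime prime_gt_1_nat by blast
  have carU: "carrier (units_of R) = Units R" by (simp add: units_of_carrier)
  let ?f = "act_class N :: int \<Rightarrow> (int ^ 'd) set \<Rightarrow> _" and ?X = "tuple_class N n"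
  let ?H = "{x \<in> carrier (units_of R). ?f x ?X = ?X}"
  have fin: "finite (carrier (units_of R))" by (simp add: carU)
  have act: "?f x (tuple_class N n') = tuple_class N (scale_tuple N x n')"
    if "x \<in> Units R" "n' \<in> distinct_tuples N" for x n'
    using act_class_tuple_class[OF N1 that[unfolded R_def]] .
  have one: "?f \<one>\<^bsub>units_of R\<^esub> ?X = ?X"
    using act[of "\<one>\<^bsub>R\<^esub>" n] n scale_tuple_one[OF N1 n]
    by (simp add: units_of_one R_def[symmetric])
  have mult: "?f (x \<otimes>\<^bsub>units_of R\<^esub> y) ?X = ?f x (?f y ?X)"
    if "x \<in> carrier (units_of R)" "y \<in> carrier (units_of R)" for x y
    using that n act scale_tuple_distinct[OF N1, of y n] scale_tuple_mult[OF N1 n, of x y]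
    by (simp add: carU units_of_mult R_def[symmetric] Units_closed)
  have order: "order (units_of R) = N - 1"
    by (simp add: order_def carU res_prime_units_eq)
  \<comment> \<open>A primitive root modulo \<open>N\<close>, from the cyclicity of the
    multiplicative group of a finite field.\<close>
  obtain g where g: "g \<in> carrier (units_of R)"
    "carrier (units_of R) = range (\<lambda>i::nat. g [^]\<^bsub>units_of R\<^esub> i)"
    using finite_field_mult_group_has_gen[OF finite]
    by (auto simp: mult_of_is_Units units_of_pow carU full_SetCompr_eq)
  have H: "subgroup ?H (units_of R)"
    using U.subgroup_stabilizer[where f = ?f and X = ?X, OF fin one mult] .
  obtain a where a: "a \<in> ?H" "group.ord (units_of R) a = card ?H"
    by (rule U.subgroup_of_cyclic_generator[OF fin g H])
  have "card (class_orbit N ?X) * card ?H = N - 1"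
    using U.card_orbit_times_stabilizer[where f = ?f and X = ?X, OF fin one mult] order
    by (simp add: class_orbit_def R_def units_of_carrier)
  then show ?thesis using a that[of a] by (simp add: carU)
qed

text \<open>Iterating \<open>q\<close> multiplies the entries of \<open>n\<close> by powers of
  \<open>a\<close>. Hence the same exponents trivialize \<open>perm_mat q\<close> and
  \<open>a\<close>, and these exponents determine the order.\<close>

lemma generate_perm_mat_card:
  fixes n :: "int ^ 'd"
  assumes prime: "prime N" and n: "n \<in> distinct_tuples N" and nondeg: "n \<noteq> 0 \<or> N = 2"
    and a: "a \<in> Units (residue_ring (int N))"
    and q: "bij q" "\<And>i. scale_tuple N a n $ i = n $ q i"
  shows "card (generate unitary_group {perm_mat q}) = group.ord (units_of (residue_ring (int N))) a"
proof -
  define R where "R = residue_ring (int N)"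
  interpret residues_prime N R using prime by unfold_locales (auto simp: R_def)
  interpret U: group "units_of R" by (rule units_group)
  interpret M: group "unitary_group :: (complex ^ 'd ^ 'd) monoid" by (rule group_unitary_group)
  have aU: "a \<in> Units R" using a by (simp add: R_def)
  have nc: "n $ i \<in> carrier R" for i using n by (simp add: distinct_tuples_def R_def)
  have inj: "n $ i = n $ j \<longleftrightarrow> i = j" for i j
    using n by (auto simp: distinct_tuples_def inj_def)
  have q': "n $ q i = a \<otimes>\<^bsub>R\<^esub> n $ i" for i
    using q(2)[of i] by (simp add: scale_tuple_def R_def)
  have iter: "n $ (q ^^ k) i = (a [^]\<^bsub>R\<^esub> k) \<otimes>\<^bsub>R\<^esub> n $ i" for k i
  proof (induction k)
    case (Suc k)
    then show ?case using nc aU Units_closed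
      by (simp add: q' m_assoc[symmetric] nat_pow_Suc2[symmetric] del: nat_pow_Suc)
  qed (simp add: nc)
  have pow: "q ^^ k = id \<longleftrightarrow> a [^]\<^bsub>R\<^esub> k = \<one>\<^bsub>R\<^esub>" for k
  proof
    assume id: "q ^^ k = id"
    have fix_n: "(a [^]\<^bsub>R\<^esub> k) \<otimes>\<^bsub>R\<^esub> n $ i = n $ i" for i using iter[of k i] id by simp
    from nondeg show "a [^]\<^bsub>R\<^esub> k = \<one>\<^bsub>R\<^esub>"
    proof
      \<comment> \<open>In the field of residues a nonzero entry fixed by a power of
        \<open>a\<close> can be cancelled.\<close>
      assume "n \<noteq> 0"
      then obtain i where "n $ i \<noteq> \<zero>\<^bsub>R\<^esub>" by (auto simp: vec_eq_iff res_zero_eq)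
      then show ?thesis
        using fix_n[of i] nc[of i] m_rcancel[of "n $ i" "a [^]\<^bsub>R\<^esub> k" "\<one>\<^bsub>R\<^esub>"]
          aU Units_closed by simp
    next
      \<comment> \<open>Here the unit group is trivial.\<close>
      assume "N = 2"
      then show ?thesis
        using Units_pow_closed[OF aU, of k] by (simp add: res_prime_units_eq res_one_eq)
    qed
  next
    assume "a [^]\<^bsub>R\<^esub> k = \<one>\<^bsub>R\<^esub>"
    \<comment> \<open>The iterate fixes every entry value, and distinct entries make it fix every
      index.\<close>
    then show "q ^^ k = id" using iter[of k] nc inj by (simp add: fun_eq_iff)
  qed
  have unitary_one: "\<one>\<^bsub>unitary_group\<^esub> = (mat 1 :: complex ^ 'd ^ 'd)"
    by (simp add: unitary_group_def)
  have Q: "perm_mat q \<in> carrier unitary_group"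
    using permutation_matrix_unitary[OF permutation_matrix_perm_mat[OF q(1)]] .
  have "perm_mat q [^]\<^bsub>unitary_group\<^esub> k = \<one>\<^bsub>unitary_group\<^esub>
      \<longleftrightarrow> group.ord (units_of R) a dvd k" for k :: nat
    using U.pow_eq_id[of a k] aU pow[of k]
    by (simp add: perm_mat_pow unitary_one perm_mat_eq_one_iff units_of_carrier units_of_pow
        units_of_one)
  then have "M.ord (perm_mat q) = group.ord (units_of R) a"
    using M.ord_unique[OF Q] by blast
  then show ?thesis using M.generate_pow_card[OF Q] by (simp add: R_def)
qed

theorem theorem5p1:
  fixes N c :: nat and n :: "int ^ 'd"
  assumes "prime N"
    and "CARD('d) \<le> N"
    and "n \<in> distinct_tuples N"
    and "c > 0"
    and "real (card (class_orbit N (tuple_class N n))) = (real N - 1) / real c"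
    and nondegenerate: "n \<noteq> 0 \<or> N = 2"
  shows "\<exists>Q :: complex ^ 'd ^ 'd.
           permutation_matrix Q \<and>
           card (generate unitary_group {Q}) = c \<and>
           generate unitary_group {diag (\<chi> j. root_unity N powi (n $ j)), Q}
             \<subseteq> Sym (harmonic_frame N n)"
proof -
  let ?R = "residue_ring (int N)" and ?X = "tuple_class N n"
  have N1: "1 < N" using assms(1) prime_gt_1_nat by blast
  interpret residues "int N" ?R using N1 by unfold_locales auto
  obtain a where a: "a \<in> Units ?R" and stab: "act_class N a ?X = ?X"
    and count: "card (class_orbit N ?X) * group.ord (units_of ?R) a = N - 1"
    using stabilizer_generator[OF assms(1,3)] by metis
  have "real (card (class_orbit N ?X) * c) = real (N - 1)"
    using assms(4,5) N1 by (simp add: of_nat_diff)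
  then have "card (class_orbit N ?X) * c = N - 1" by linarith
  \<comment> \<open>Both numbers complete the orbit size to \<open>N - 1\<close>, which is positive,
    so the orbit size cancels.\<close>
  then have ord: "group.ord (units_of ?R) a = c"
    using count N1 by (metis mult_cancel1 mult_is_0 zero_less_diff less_irrefl)
  have "tuple_class N (scale_tuple N a n) = ?X"
    using stab act_class_tuple_class[OF N1 a assms(3)] by simp
  \<comment> \<open>A unit fixing the class permutes the entries of \<open>n\<close>; this
    permutation supplies the matrix.\<close>
  then obtain q where q: "bij q" "\<And>i. scale_tuple N a n $ i = n $ q i"
    using tuple_class_eqD[OF assms(3) scale_tuple_distinct[OF N1 a assms(3)]] by metis
  have "[a * n $ i = n $ q i] (mod int N)" for i
    using q(2)[of i] by (simp add: scale_tuple_def res_mult_eq cong_def flip: q(2))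
  moreover have "a \<ge> 0" using a by (simp add: res_units_eq)
  ultimately have "perm_mat q \<in> Sym (harmonic_frame N n)"
    using perm_mat_in_Sym q(1) N1 by (metis gr_zeroI not_less0)
  \<comment> \<open>Since \<open>Sym\<close> is a subgroup, it suffices that it contains the two
    generators.\<close>
  then have "generate unitary_group {diag (\<chi> j. root_unity N powi (n $ j)), perm_mat q}
      \<subseteq> Sym (harmonic_frame N n)"
    using diag_in_Sym[of N n] N1
    by (intro group.generate_subgroup_incl[OF group_unitary_group _ subgroup_Sym]) auto
  then show ?thesis
    using generate_perm_mat_card[OF assms(1,3) nondegenerate a q] ord
      permutation_matrix_perm_mat[OF q(1)] by auto
qed

end
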